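(* Let $I$ be a finite set and let $\mathrm{Ev}_I\subseteq\{0,1\}^I$ be the set of binary strings containing an even number of $1$'s. A simplicial complex over $I$ generates $\mathrm{Ev}_I$ if and only if it is connected. Therefore, the minimal complexes generating $\mathrm{Ev}_I$ are the trees spanning $I$.
   Context: All sets are finite. For $f:B^J\to A^I$ write $f_i(x)=f(x)_i$. For $i\in I$, the input window $\mathcal{W}_f(i)$ is the smallest set $W\subseteq J$ (it exists) such that for all $x,y\in B^J$, $x|_W=y|_W$ implies $f_i(x)=f_i(y)$. A simplicial complex (or complex) over a set $I$ is a collection of subsets of $I$, called its simplices, that is closed under taking subsets. The communication complex $K_f$ of $f$ is the complex over $I$ defined, for $S\subseteq I$, by: $S\in K_f$ iff $\bigcap_{i\in S}\mathcal{W}_f(i)\neq\emptyset$ (for $S=\emptyset$ the intersection is $J$). A complex $K$ over $I$ generates a language $L\subseteq A^I$ if there exist finite sets $B,J$ and a function $f:B^J\to A^I$ with image exactly $L$ and $K_f\subseteq K$. A complex generating $L$ is minimal if no complex strictly contained in it generates $L$. A complex over $I$ is disconnected if there is a partition $I=I_0\sqcup I_1$ into two non-empty sets such that every simplex is contained in $I_0$ or in $I_1$; otherwise it is connected. A tree spanning $I$ is a tree with vertex set $I$, regarded as a complex whose simplices are its vertices and edges (and the empty set).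
   Formalization: The claim that the minimal complexes generating Ev_I are the trees spanning I is proved for |I| ≥ 2; for |I| ≤ 1 it fails, since the empty collection of simplices already generates Ev_I and is the only minimal complex, but is not a tree spanning I. *)

theory Defs
  imports Main "HOL-Library.FuncSet"
begin

text \<open>
  The set of functions \<open>J \<rightarrow> B\<close> is rendered as the extensional function space
  \<open>J \<rightarrow>\<^sub>E B\<close>, so that for finite \<open>J\<close> and \<open>B\<close> it is finite and an element is determined by its
  values on \<open>J\<close>.
\<close>

section \<open>Complexes\<close>

text \<open>The empty collection of simplices is a complex; it differs from \<open>{{}}\<close>.\<close>

definition complex_over :: "'i set \<Rightarrow> 'i set set \<Rightarrow> bool" where
  "complex_over I K \<longleftrightarrow> K \<subseteq> Pow I \<and> (\<forall>S\<in>K. \<forall>T. T \<subseteq> S \<longrightarrow> T \<in> K)"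

definition complex_disconnected :: "'i set \<Rightarrow> 'i set set \<Rightarrow> bool" where
  "complex_disconnected I K \<longleftrightarrow>
     (\<exists>I0 I1. I = I0 \<union> I1 \<and> I0 \<inter> I1 = {} \<and> I0 \<noteq> {} \<and> I1 \<noteq> {} \<and>
              (\<forall>S\<in>K. S \<subseteq> I0 \<or> S \<subseteq> I1))"

definition complex_connected :: "'i set \<Rightarrow> 'i set set \<Rightarrow> bool" where
  "complex_connected I K \<longleftrightarrow> \<not> complex_disconnected I K"

section \<open>Trees\<close>

text \<open>Graphs are simple and undirected; edges are two-element sets of vertices.\<close>

definition simple_graph :: "'i set \<Rightarrow> 'i set set \<Rightarrow> bool" where
  "simple_graph V E \<longleftrightarrow> (\<forall>e\<in>E. e \<subseteq> V \<and> card e = 2)"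

definition graph_connected :: "'i set \<Rightarrow> 'i set set \<Rightarrow> bool" where
  "graph_connected V E \<longleftrightarrow> (\<forall>u\<in>V. \<forall>v\<in>V. (u, v) \<in> {(a, b). {a, b} \<in> E}\<^sup>*)"

definition graph_cycle :: "'i set set \<Rightarrow> 'i list \<Rightarrow> bool" where
  "graph_cycle E vs \<longleftrightarrow> 3 \<le> length vs \<and> distinct vs \<and>
     (\<forall>k<length vs. {vs ! k, vs ! (Suc k mod length vs)} \<in> E)"

definition is_tree :: "'i set \<Rightarrow> 'i set set \<Rightarrow> bool" where
  "is_tree V E \<longleftrightarrow> V \<noteq> {} \<and> simple_graph V E \<and> graph_connected V E \<and> (\<nexists>vs. graph_cycle E vs)"

definition tree_spanning :: "'i set \<Rightarrow> 'i set set \<Rightarrow> bool" where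
  "tree_spanning I K \<longleftrightarrow> (\<exists>E. is_tree I E \<and> K = {{}} \<union> {{v} | v. v \<in> I} \<union> E)"

section \<open>Input windows and generation\<close>

definition determines ::
  "'j set \<Rightarrow> 'b set \<Rightarrow> (('j \<Rightarrow> 'b) \<Rightarrow> 'i \<Rightarrow> 'a) \<Rightarrow> 'i \<Rightarrow> 'j set \<Rightarrow> bool" where
  "determines J B f i W \<longleftrightarrow> W \<subseteq> J \<and>
     (\<forall>x\<in>J \<rightarrow>\<^sub>E B. \<forall>y\<in>J \<rightarrow>\<^sub>E B. restrict x W = restrict y W \<longrightarrow> f x i = f y i)"

text \<open>\<open>LEAST\<close> is with respect to inclusion; it exists for finite \<open>J\<close>, see \<open>input_window\<close> below.\<close>

definition input_window ::
  "'j set \<Rightarrow> 'b set \<Rightarrow> (('j \<Rightarrow> 'b) \<Rightarrow> 'i \<Rightarrow> 'a) \<Rightarrow> 'i \<Rightarrow> 'j set" where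
  "input_window J B f i = (LEAST W. determines J B f i W)"

text \<open>Intersecting with \<open>J\<close> only matters for \<open>S = {}\<close>, where the intersection is \<open>J\<close> by convention.\<close>

definition communication_complex ::
  "'i set \<Rightarrow> 'j set \<Rightarrow> 'b set \<Rightarrow> (('j \<Rightarrow> 'b) \<Rightarrow> 'i \<Rightarrow> 'a) \<Rightarrow> 'i set set" where
  "communication_complex I J B f =
     {S. S \<subseteq> I \<and> J \<inter> (\<Inter>i\<in>S. input_window J B f i) \<noteq> {}}"

text \<open>
  HOL cannot quantify over types inside a formula, so the finite sets \<open>B\<close> and \<open>J\<close> are
  taken among the finite sets of natural numbers. This is no restriction, see \<open>generatesI\<close>.
\<close>

definition generates :: "'i set \<Rightarrow> 'a set \<Rightarrow> 'i set set \<Rightarrow> ('i \<Rightarrow> 'a) set \<Rightarrow> bool" where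
  "generates I A K L \<longleftrightarrow>
     (\<exists>(B :: nat set) (J :: nat set) (f :: (nat \<Rightarrow> nat) \<Rightarrow> 'i \<Rightarrow> 'a).
        finite B \<and> finite J \<and> f \<in> (J \<rightarrow>\<^sub>E B) \<rightarrow> (I \<rightarrow>\<^sub>E A) \<and> f ` (J \<rightarrow>\<^sub>E B) = L \<and>
        communication_complex I J B f \<subseteq> K)"

definition minimal_generating :: "'i set \<Rightarrow> 'a set \<Rightarrow> 'i set set \<Rightarrow> ('i \<Rightarrow> 'a) set \<Rightarrow> bool" where
  "minimal_generating I A K L \<longleftrightarrow>
     complex_over I K \<and> generates I A K L \<and>
     (\<forall>K'. complex_over I K' \<and> K' \<subset> K \<longrightarrow> \<not> generates I A K' L)"

definition Ev :: "'i set \<Rightarrow> ('i \<Rightarrow> nat) set" where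
  "Ev I = {x \<in> I \<rightarrow>\<^sub>E {0, 1}. even (card {i \<in> I. x i = 1})}"

section \<open>Adequacy of the definitions\<close>

lemma determines_Int:
  assumes V: "determines J B f i V" and W: "determines J B f i W"
  shows "determines J B f i (V \<inter> W)"
  unfolding determines_def
proof (intro conjI ballI impI)
  show "V \<inter> W \<subseteq> J" using V by (auto simp: determines_def)
  fix x y assume x: "x \<in> J \<rightarrow>\<^sub>E B" and y: "y \<in> J \<rightarrow>\<^sub>E B"
    and eq: "restrict x (V \<inter> W) = restrict y (V \<inter> W)"
  define z where "z = (\<lambda>j. if j \<in> V then x j else y j)"
  have VJ: "V \<subseteq> J" using V by (auto simp: determines_def)
  have z: "z \<in> J \<rightarrow>\<^sub>E B"
    using x y VJ by (auto simp: z_def PiE_iff extensional_def)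
  have "restrict x V = restrict z V"
    by (auto simp: z_def restrict_def)
  hence 1: "f x i = f z i" using V x z unfolding determines_def by blast
  have "x j = y j" if "j \<in> V" "j \<in> W" for j
  proof -
    have "restrict x (V \<inter> W) j = restrict y (V \<inter> W) j" by (simp only: eq)
    thus ?thesis using that by (simp add: restrict_def)
  qed
  hence "z j = y j" if "j \<in> W" for j
    using that by (cases "j \<in> V") (simp_all add: z_def)
  hence "restrict z W = restrict y W"
    by (intro restrict_ext)
  hence 2: "f z i = f y i" using W y z unfolding determines_def by blast
  show "f x i = f y i" using 1 2 by simp
qed

lemma determines_self: "determines J B f i J"
  by (auto simp: determines_def PiE_restrict)

lemma input_window:
  assumes "finite J"
  shows "determines J B f i (input_window J B f i)"
    and "determines J B f i W \<Longrightarrow> input_window J B f i \<subseteq> W"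
proof -
  obtain M where M: "determines J B f i M"
    and min: "\<And>W. determines J B f i W \<Longrightarrow> card M \<le> card W"
    using ex_has_least_nat[of "determines J B f i" J card, OF determines_self] by blast
  have "finite M" using M assms by (auto simp: determines_def intro: finite_subset)
  have sub: "M \<subseteq> W" if "determines J B f i W" for W
  proof -
    have "card M \<le> card (M \<inter> W)" using min determines_Int[OF M that] by blast
    hence "M \<inter> W = M" using \<open>finite M\<close> by (intro card_seteq) auto
    thus ?thesis by blast
  qed
  have eq: "input_window J B f i = M"
    unfolding input_window_def using M sub by (rule Least_equality)
  show "determines J B f i (input_window J B f i)" using M eq by simp
  show "determines J B f i W \<Longrightarrow> input_window J B f i \<subseteq> W" using sub eq by simp
qed

lemma generatesI:
  fixes B :: "'b set" and J :: "'j set" and f :: "('j \<Rightarrow> 'b) \<Rightarrow> 'i \<Rightarrow> 'a"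
  assumes "finite B" "finite J" and f: "f \<in> (J \<rightarrow>\<^sub>E B) \<rightarrow> (I \<rightarrow>\<^sub>E A)"
    and im: "f ` (J \<rightarrow>\<^sub>E B) = L" and K: "communication_complex I J B f \<subseteq> K"
  shows "generates I A K L"
proof -
  obtain g :: "'j \<Rightarrow> nat" where g: "inj_on g J"
    using finite_imp_inj_to_nat_seg[OF \<open>finite J\<close>] by blast
  obtain h :: "'b \<Rightarrow> nat" where h: "inj_on h B"
    using finite_imp_inj_to_nat_seg[OF \<open>finite B\<close>] by blast
  define J' where "J' = g ` J"
  define B' where "B' = h ` B"
  define dec where "dec y = restrict (\<lambda>j. inv_into B h (y (g j))) J" for y :: "nat \<Rightarrow> nat"
  define f' where "f' y = f (dec y)" for y
  have fin: "finite B'" "finite J'" using assms(1,2) by (auto simp: B'_def J'_def)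
  have dec: "dec y \<in> J \<rightarrow>\<^sub>E B" if "y \<in> J' \<rightarrow>\<^sub>E B'" for y
  proof -
    have "inv_into B h (y (g j)) \<in> B" if "j \<in> J" for j
    proof -
      have "y (g j) \<in> h ` B" using \<open>y \<in> J' \<rightarrow>\<^sub>E B'\<close> that by (auto simp: J'_def B'_def PiE_iff)
      thus ?thesis by (rule inv_into_into)
    qed
    thus ?thesis by (auto simp: dec_def PiE_iff)
  qed
  have surj: "x \<in> dec ` (J' \<rightarrow>\<^sub>E B')" if x: "x \<in> J \<rightarrow>\<^sub>E B" for x
  proof -
    define y where "y = restrict (\<lambda>k. h (x (inv_into J g k))) J'"
    have "y \<in> J' \<rightarrow>\<^sub>E B'"
      using x by (auto simp: y_def J'_def B'_def PiE_iff inv_into_f_f[OF g])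
    moreover have "dec y = x"
    proof
      fix j show "dec y j = x j"
      proof (cases "j \<in> J")
        case True
        hence "x j \<in> B" using x by (auto simp: PiE_iff)
        with True show ?thesis
          by (simp add: dec_def y_def J'_def inv_into_f_f[OF g] inv_into_f_f[OF h])
      next
        case False
        thus ?thesis using x by (auto simp: dec_def PiE_iff extensional_def)
      qed
    qed
    ultimately show ?thesis by force
  qed
  have decim: "dec ` (J' \<rightarrow>\<^sub>E B') = J \<rightarrow>\<^sub>E B" using dec surj by blast
  have im': "f' ` (J' \<rightarrow>\<^sub>E B') = L"
    unfolding im[symmetric] decim[symmetric] by (auto simp: f'_def image_image)
  have f': "f' \<in> (J' \<rightarrow>\<^sub>E B') \<rightarrow> (I \<rightarrow>\<^sub>E A)"
    unfolding f'_def
  proof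
    fix y assume "y \<in> J' \<rightarrow>\<^sub>E B'"
    from dec[OF this] show "f (dec y) \<in> I \<rightarrow>\<^sub>E A" by (rule funcset_mem[OF f])
  qed
  have win: "input_window J' B' f' i \<subseteq> g ` input_window J B f i" for i
  proof (rule input_window(2)[OF fin(2)])
    let ?W = "input_window J B f i"
    have W: "determines J B f i ?W" by (rule input_window(1)[OF \<open>finite J\<close>])
    show "determines J' B' f' i (g ` ?W)"
      unfolding determines_def
    proof (intro conjI ballI impI)
      show "g ` ?W \<subseteq> J'" using W by (auto simp: determines_def J'_def)
      fix x y assume x: "x \<in> J' \<rightarrow>\<^sub>E B'" and y: "y \<in> J' \<rightarrow>\<^sub>E B'"
        and eq: "restrict x (g ` ?W) = restrict y (g ` ?W)"
      have "x (g j) = y (g j)" if "j \<in> ?W" for j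
        using fun_cong[OF eq, of "g j"] that by simp
      hence "restrict (dec x) ?W = restrict (dec y) ?W"
        by (auto simp: dec_def restrict_def)
      thus "f' x i = f' y i"
        using W dec[OF x] dec[OF y] unfolding determines_def f'_def by blast
    qed
  qed
  have "communication_complex I J' B' f' \<subseteq> communication_complex I J B f"
  proof
    fix S assume "S \<in> communication_complex I J' B' f'"
    then obtain k where "S \<subseteq> I" "k \<in> J'" and k: "\<And>i. i \<in> S \<Longrightarrow> k \<in> input_window J' B' f' i"
      by (auto simp: communication_complex_def)
    then obtain j where j: "j \<in> J" "k = g j" by (auto simp: J'_def)
    have "j \<in> input_window J B f i" if "i \<in> S" for i
    proof -
      have "k \<in> g ` input_window J B f i" using k[OF that] win[of i] by blast
      then obtain l where l: "l \<in> input_window J B f i" "g j = g l"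
        unfolding j(2) by (rule imageE)
      hence "l \<in> J" using input_window(1)[OF \<open>finite J\<close>, of B f i] by (auto simp: determines_def)
      thus ?thesis using l inj_onD[OF g l(2) j(1)] by simp
    qed
    thus "S \<in> communication_complex I J B f"
      using \<open>S \<subseteq> I\<close> j by (auto simp: communication_complex_def)
  qed
  hence "communication_complex I J' B' f' \<subseteq> K" using K by (rule subset_trans)
  with fin f' im' show ?thesis
    unfolding generates_def
    by (intro exI[of _ B'] exI[of _ J'] exI[of _ f'] conjI)
qed

text \<open>
  If \<open>I\<close> has at most one element then \<open>Ev I\<close> is a singleton and is generated by the empty
  complex (no inputs at all), which is then the only minimal one and is not a tree spanning \<open>I\<close>.
\<close>

lemma minimal_generating_Ev_degenerate:
  assumes "finite I" "card I \<le> 1"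
  shows "minimal_generating I {0, 1} K (Ev I) \<longleftrightarrow> K = {}"
    and "\<not> tree_spanning I {}"
proof -
  define z where "z = restrict (\<lambda>_. 0 :: nat) I"
  have Ev: "Ev I = {z}"
  proof (cases "I = {}")
    case True
    thus ?thesis by (auto simp: Ev_def z_def)
  next
    case False
    then obtain a where a: "I = {a}"
      using assms by (metis One_nat_def card_1_singletonE card_gt_0_iff le_antisym less_eq_Suc_le)
    have "x = z" if "x \<in> Ev I" for x
    proof
      fix i
      have "x a = 0 \<or> x a = 1" and ext: "x \<in> extensional I"
        and ev: "even (card {i \<in> I. x i = 1})"
        using that a by (auto simp: Ev_def PiE_iff)
      moreover have "x a \<noteq> 1"
      proof
        assume "x a = 1"
        hence "{i \<in> I. x i = 1} = {a}" using a by auto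
        thus False using ev by simp
      qed
      ultimately show "x i = z i" using a by (auto simp: z_def extensional_def)
    qed
    moreover have "z \<in> Ev I" by (auto simp: Ev_def z_def cong: conj_cong)
    ultimately show ?thesis by blast
  qed
  have gen: "generates I {0, 1} {} (Ev I)"
    by (rule generatesI[of "{} :: nat set" "{} :: nat set" "\<lambda>_. z"])
       (auto simp: Ev communication_complex_def z_def)
  thus "minimal_generating I {0, 1} K (Ev I) \<longleftrightarrow> K = {}"
    by (auto simp: minimal_generating_def complex_over_def)
  show "\<not> tree_spanning I {}" by (auto simp: tree_spanning_def)
qed

end

theory Submission
  imports Defs
begin

text \<open>
  If the complex is disconnected, the two parts of a partition read disjoint sets of inputs, so two
  even outputs can be combined into an odd one. If it is connected, put one bit on every
  edge and let every vertex output the parity of the bits on its edges: the output is even since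
  every edge has two ends, and the edges of a path from \<open>u\<close> to \<open>v\<close> toggle exactly the outputs at
  \<open>u\<close> and \<open>v\<close>. The minimal complexes are then those of the minimal connected graphs,
  which are the trees.
\<close>

section \<open>Connectivity of complexes and graphs\<close>

abbreviation adj :: "'i set set \<Rightarrow> ('i \<times> 'i) set" where
  "adj E \<equiv> {(a, b). {a, b} \<in> E}"

text \<open>Connectivity of a complex over \<open>I\<close> depends only on these simplices: it is
  equivalent to connectivity of the graph they form on \<open>I\<close>. This reduces the whole
  development to graphs.\<close>

definition edges :: "'i set set \<Rightarrow> 'i set set" where
  "edges K = {e \<in> K. card e = 2}"

lemma simple_graph_edges: "complex_over I K \<Longrightarrow> simple_graph I (edges K)"
  by (auto simp: simple_graph_def edges_def complex_over_def)

lemma adj_rtrancl_sym: "(a, b) \<in> (adj E)\<^sup>* \<Longrightarrow> (b, a) \<in> (adj E)\<^sup>*"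
  by (rule symD[OF sym_rtrancl]) (auto simp: sym_def insert_commute)

text \<open>The set \<open>R\<close> of vertices reachable from \<open>u\<close> and its complement
  would disconnect \<open>K\<close>. A simplex meeting both contains, by closure under subsets, an
  edge leaving \<open>R\<close>, which is impossible.\<close>

lemma graph_connected_edges:
  assumes K: "complex_over I K" and conn: "complex_connected I K"
  shows "graph_connected I (edges K)"
  unfolding graph_connected_def
proof (intro ballI)
  fix u v assume u: "u \<in> I" and v: "v \<in> I"
  define R where "R = {w \<in> I. (u, w) \<in> (adj (edges K))\<^sup>*}"
  have "S \<subseteq> R \<or> S \<subseteq> I - R" if S: "S \<in> K" for S
  proof (rule ccontr)
    have SI: "S \<subseteq> I" using S K by (auto simp: complex_over_def)
    assume "\<not> (S \<subseteq> R \<or> S \<subseteq> I - R)"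
    with SI obtain a b where ab: "a \<in> S" "a \<in> R" "b \<in> S" "b \<notin> R" by blast
    hence "{a, b} \<in> K" "a \<noteq> b" using S K by (auto simp: complex_over_def)
    hence "(a, b) \<in> adj (edges K)" by (auto simp: edges_def)
    hence "b \<in> R" using ab SI by (auto simp: R_def intro: rtrancl_into_rtrancl)
    thus False using ab by blast
  qed
  moreover have "u \<in> R" using u by (auto simp: R_def)
  moreover have "R \<subseteq> I" by (auto simp: R_def)
  ultimately have "I - R = {}"
    using conn unfolding complex_connected_def complex_disconnected_def
    by (metis Diff_disjoint Diff_partition empty_iff)
  thus "(u, v) \<in> (adj (edges K))\<^sup>*" using v by (auto simp: R_def)
qed

text \<open>Every edge of a path lies within one block of a partition that respects
  \<open>K\<close>, so a path starting in \<open>P\<close> can never reach \<open>Q\<close>.\<close>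

lemma complex_connectedI:
  assumes "graph_connected I E" and "E \<subseteq> K"
  shows "complex_connected I K"
  unfolding complex_connected_def complex_disconnected_def
proof (intro notI, elim exE conjE)
  fix P Q assume PQ: "I = P \<union> Q" "P \<inter> Q = {}" "P \<noteq> {}" "Q \<noteq> {}"
    and K: "\<forall>S\<in>K. S \<subseteq> P \<or> S \<subseteq> Q"
  then obtain p q where p: "p \<in> P" and q: "q \<in> Q" by blast
  have "(p, q) \<in> (adj E)\<^sup>*" using assms(1) p q PQ by (auto simp: graph_connected_def)
  hence "q \<in> P"
  proof (induction rule: rtrancl_induct)
    case base show ?case by (rule p)
  next
    case (step y z)
    hence "{y, z} \<in> K" using assms(2) by auto
    with K step.IH PQ(2) show ?case by blast
  qed
  thus False using q PQ by blast
qed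

text \<open>By closure under subsets, a missing vertex \<open>v\<close> lies in no simplex at all,
  so \<open>{v}\<close> splits off from the rest of \<open>I\<close>; the rest is non-empty because
  \<open>I\<close> has a second element.\<close>

lemma connected_vertex_in_complex:
  assumes K: "complex_over I K" and conn: "complex_connected I K"
    and "2 \<le> card I" and v: "v \<in> I"
  shows "{v} \<in> K"
proof (rule ccontr)
  assume nv: "{v} \<notin> K"
  have "I \<noteq> {v}" using assms(3) by auto
  hence "I - {v} \<noteq> {}" using v by blast
  moreover have "S \<subseteq> I - {v}" if "S \<in> K" for S
    using that nv K by (auto simp: complex_over_def)
  ultimately have "complex_disconnected I K"
    unfolding complex_disconnected_def using v
    by (intro exI[of _ "{v}"] exI[of _ "I - {v}"]) auto
  thus False using conn by (simp add: complex_connected_def)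
qed

section \<open>Spanning trees\<close>

text \<open>Turns reachability into a simple path in the list format of \<open>graph_cycle\<close>.
  The walk is extended step by step, and loops are cut as soon as they close.\<close>

lemma rtrancl_adj_path:
  assumes "(a, b) \<in> (adj E)\<^sup>*"
  obtains vs where "vs \<noteq> []" "distinct vs" "vs ! 0 = a" "vs ! (length vs - 1) = b"
    "\<And>k. Suc k < length vs \<Longrightarrow> {vs ! k, vs ! Suc k} \<in> E"
proof -
  have "\<exists>vs. vs \<noteq> [] \<and> distinct vs \<and> vs ! 0 = a \<and> vs ! (length vs - 1) = b \<and>
      (\<forall>k. Suc k < length vs \<longrightarrow> {vs ! k, vs ! Suc k} \<in> E)"
    using assms
  proof (induction rule: rtrancl_induct)
    case base
    show ?case by (intro exI[of _ "[a]"]) auto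
  next
    case (step y z)
    then obtain vs where vs: "vs \<noteq> []" "distinct vs" "vs ! 0 = a" "vs ! (length vs - 1) = y"
      "\<And>k. Suc k < length vs \<Longrightarrow> {vs ! k, vs ! Suc k} \<in> E" by blast
    show ?case
    proof (cases "z \<in> set vs")
      case True
      then obtain k where k: "k < length vs" "vs ! k = z" by (auto simp: in_set_conv_nth)
      \<comment> \<open>The walk returns to \<open>z\<close> at position \<open>k\<close>, so the
        path is cut back to end at that earlier occurrence.\<close>
      show ?thesis
        by (rule exI[of _ "take (Suc k) vs"]) (use vs k in \<open>auto simp: min_absorb2 Suc_leI\<close>)
    next
      case False
      have "{(vs @ [z]) ! k, (vs @ [z]) ! Suc k} \<in> E" if "k < length vs" for k
      proof (cases "Suc k < length vs")
        case True
        thus ?thesis using vs(5)[OF True] by (simp add: nth_append)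
      next
        case False
        hence "k = length vs - 1" using that by simp
        thus ?thesis using vs(1,4) step.hyps(2) that by (simp add: nth_append)
      qed
      thus ?thesis using vs False
        by (intro exI[of _ "vs @ [z]"]) (auto simp: nth_append)
    qed
  qed
  thus thesis using that by blast
qed

text \<open>The new edge closes a simple path from \<open>a\<close> to \<open>b\<close> into a
  cycle. The path has at least three vertices: one would force \<open>a = b\<close>, and two would
  put \<open>{a, b}\<close> into \<open>E\<close>.\<close>

lemma graph_cycle_insert:
  assumes conn: "(a, b) \<in> (adj E)\<^sup>*" and "a \<noteq> b" and "{a, b} \<notin> E"
  shows "\<exists>vs. graph_cycle (insert {a, b} E) vs"
proof -
  obtain vs where vs: "vs \<noteq> []" "distinct vs" "vs ! 0 = a" "vs ! (length vs - 1) = b"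
    and E: "\<And>k. Suc k < length vs \<Longrightarrow> {vs ! k, vs ! Suc k} \<in> E"
    using rtrancl_adj_path[OF conn] by blast
  have "length vs \<noteq> 1" using vs assms(2) by auto
  moreover have "length vs \<noteq> 2" using E[of 0] vs(3,4) assms(3) by auto
  moreover have "length vs \<noteq> 0" using vs(1) by simp
  ultimately have len: "3 \<le> length vs" by linarith
  have "{vs ! k, vs ! (Suc k mod length vs)} \<in> insert {a, b} E" if k: "k < length vs" for k
  proof (cases "Suc k < length vs")
    case True
    thus ?thesis using E[OF True] by simp
  next
    case False
    hence "Suc k = length vs" "k = length vs - 1" using k by linarith+
    thus ?thesis using vs(3,4) by (simp add: insert_commute)
  qed
  thus ?thesis using len vs(2) unfolding graph_cycle_def by blast
qed

text \<open>The rest of the cycle is a detour around the removed edge.\<close>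

lemma graph_connected_remove_cycle_edge:
  assumes conn: "graph_connected V E" and cyc: "graph_cycle E vs"
  obtains e where "e \<in> E" "graph_connected V (E - {e})"
proof
  define n where "n = length vs"
  \<comment> \<open>The closing edge, where the index wraps to \<open>0\<close>; what remains of the
    cycle is then the list read from front to back.\<close>
  define e where "e = {vs ! (n - 1), vs ! 0}"
  have n: "3 \<le> n" and dist: "distinct vs"
    and E: "\<And>k. k < n \<Longrightarrow> {vs ! k, vs ! (Suc k mod n)} \<in> E"
    using cyc by (auto simp: graph_cycle_def n_def)
  have "Suc (n - 1) mod n = 0" using n by simp
  with E[of "n - 1"] n show "e \<in> E" by (simp add: e_def)
  let ?r = "adj (E - {e})"
  have step: "(vs ! k, vs ! Suc k) \<in> ?r" if k: "Suc k < n" for k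
  proof -
    have inj: "vs ! i = vs ! j \<longleftrightarrow> i = j" if "i < n" "j < n" for i j
      using nth_eq_iff_index_eq[OF dist] that by (simp add: n_def)
    \<comment> \<open>Equality would need \<open>k = 0\<close> and \<open>Suc k = n - 1\<close>,
      hence \<open>n = 2\<close>; this is where a cycle must have length at least three.\<close>
    have "{vs ! k, vs ! Suc k} \<noteq> e"
      unfolding e_def doubleton_eq_iff using k n by (simp add: inj) linarith
    thus ?thesis using E[of k] k by simp
  qed
  have reach: "(vs ! 0, vs ! k) \<in> ?r\<^sup>*" if "k < n" for k
    using that
  proof (induction k)
    case (Suc k)
    thus ?case using step by (meson Suc_lessD rtrancl.rtrancl_into_rtrancl)
  qed simp
  have ends: "(vs ! 0, vs ! (n - 1)) \<in> ?r\<^sup>*" using reach n by simp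
  \<comment> \<open>Only \<open>e\<close> itself needs the detour, taken in either direction; every
    other edge is still present.\<close>
  have "(a, b) \<in> ?r\<^sup>*" if "{a, b} \<in> E" for a b
  proof (cases "{a, b} = e")
    case True
    thus ?thesis using ends adj_rtrancl_sym[OF ends] by (auto simp: e_def doubleton_eq_iff)
  next
    case False
    thus ?thesis using that by blast
  qed
  hence "adj E \<subseteq> ?r\<^sup>*" by auto
  hence "(adj E)\<^sup>* \<subseteq> ?r\<^sup>*" by (metis rtrancl_subset_rtrancl)
  thus "graph_connected V (E - {e})"
    using conn unfolding graph_connected_def by blast
qed

text \<open>A connected subgraph with the fewest edges has no cycle, since an edge of a cycle could
  be removed without losing connectivity.\<close>

lemma spanning_tree_exists:
  assumes "finite V" "V \<noteq> {}" "simple_graph V E" "graph_connected V E"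
  obtains T where "T \<subseteq> E" "is_tree V T"
proof -
  have finE: "finite E"
    by (rule finite_subset[of _ "Pow V"]) (use assms in \<open>auto simp: simple_graph_def\<close>)
  obtain T where T: "T \<subseteq> E" "graph_connected V T"
    and min: "\<And>T'. T' \<subseteq> E \<Longrightarrow> graph_connected V T' \<Longrightarrow> card T \<le> card T'"
    using ex_has_least_nat[of "\<lambda>T. T \<subseteq> E \<and> graph_connected V T" E card] assms(4) by auto
  have "\<not> graph_cycle T vs" for vs
  proof
    assume "graph_cycle T vs"
    then obtain e where e: "e \<in> T" "graph_connected V (T - {e})"
      using graph_connected_remove_cycle_edge[OF T(2)] by blast
    hence "card T \<le> card (T - {e})" using min T(1) by blast
    moreover have "card (T - {e}) < card T"
      using e(1) T(1) finE by (intro card_Diff1_less) (auto intro: finite_subset)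
    ultimately show False by simp
  qed
  hence "is_tree V T" using T assms(2,3) by (auto simp: is_tree_def simple_graph_def)
  thus thesis using that T(1) by blast
qed

text \<open>The right-hand side in \<open>tree_spanning\<close>, for an arbitrary edge set, so that
  it can be handled before the graph is known to be a tree.\<close>

definition graph_complex :: "'i set \<Rightarrow> 'i set set \<Rightarrow> 'i set set" where
  "graph_complex V E = {{}} \<union> {{v} | v. v \<in> V} \<union> E"

lemma complex_over_graph_complex:
  assumes "simple_graph V E"
  shows "complex_over V (graph_complex V E)"
  unfolding complex_over_def
proof (intro conjI ballI allI impI)
  show "graph_complex V E \<subseteq> Pow V"
    using assms by (auto simp: graph_complex_def simple_graph_def)
  fix S T assume S: "S \<in> graph_complex V E" and TS: "T \<subseteq> S"
  show "T \<in> graph_complex V E"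
  proof (cases "S \<in> E")
    case True
    then obtain a b where ab: "S = {a, b}" "S \<subseteq> V"
      using assms unfolding simple_graph_def by (meson card_2_iff)
    hence "T = {} \<or> T = {a} \<or> T = {b} \<or> T = S" using TS by auto
    thus ?thesis using ab True by (auto simp: graph_complex_def)
  next
    case False
    thus ?thesis using S TS by (auto simp: graph_complex_def)
  qed
qed

text \<open>A connected complex contains the complex of a spanning tree of its edge graph, so a
  minimal one equals it. Conversely, a connected complex strictly inside a tree omits an edge whose
  ends it still joins, and that edge would close a cycle in the tree.\<close>

lemma minimal_connected_iff_tree:
  assumes "finite I" "2 \<le> card I"
  shows "complex_over I K \<and> complex_connected I K \<and>
      (\<forall>K'. complex_over I K' \<and> K' \<subset> K \<longrightarrow> \<not> complex_connected I K')
    \<longleftrightarrow> tree_spanning I K" (is "?min \<longleftrightarrow> _")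
proof
  have I: "I \<noteq> {}" using assms(2) by auto
  have tree: "complex_over I (graph_complex I E)" "complex_connected I (graph_complex I E)"
    if "is_tree I E" for E
  proof -
    have E: "simple_graph I E" "graph_connected I E" using that by (auto simp: is_tree_def)
    show "complex_over I (graph_complex I E)" by (rule complex_over_graph_complex[OF E(1)])
    show "complex_connected I (graph_complex I E)"
      by (intro complex_connectedI[OF E(2)]) (auto simp: graph_complex_def)
  qed
  \<comment> \<open>Connected complexes over \<open>I\<close> all share the empty simplex and the
    vertices, so comparing such a complex with a tree comes down to comparing edges.\<close>
  have skeleton: "{{}} \<union> {{v} | v. v \<in> I} \<subseteq> K'"
    if "complex_over I K'" "complex_connected I K'" for K'
  proof -
    have v: "{v} \<in> K'" if "v \<in> I" for v
      by (rule connected_vertex_in_complex[OF \<open>complex_over I K'\<close> \<open>complex_connected I K'\<close> assms(2) that])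
    moreover obtain w where "w \<in> I" using I by blast
    ultimately have "{} \<in> K'"
      using \<open>complex_over I K'\<close> unfolding complex_over_def by blast
    thus ?thesis using v by blast
  qed
  {
    assume K: ?min
    obtain T where T: "T \<subseteq> edges K" "is_tree I T"
      using spanning_tree_exists[OF assms(1) I simple_graph_edges graph_connected_edges] K
      by blast
    have "graph_complex I T \<subseteq> K"
      using T(1) skeleton[of K] K by (auto simp: graph_complex_def edges_def)
    hence "graph_complex I T = K" using tree[OF T(2)] K by blast
    thus "tree_spanning I K" using T(2) unfolding tree_spanning_def graph_complex_def by blast
  }
  {
    assume "tree_spanning I K"
    then obtain E where E: "is_tree I E" and K: "K = graph_complex I E"
      unfolding tree_spanning_def graph_complex_def by blast
    have False if K': "complex_over I K'" "complex_connected I K'" "K' \<subset> K" for K'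
    proof -
      have conn: "graph_connected I (edges K')" using graph_connected_edges K'(1,2) .
      have sub: "edges K' \<subseteq> E" using K'(3) K by (auto simp: edges_def graph_complex_def)
      obtain e where e: "e \<in> E" "e \<notin> K'"
        using K'(3) skeleton[OF K'(1,2)] K by (auto simp: graph_complex_def)
      then obtain a b where ab: "e = {a, b}" "a \<noteq> b" "a \<in> I" "b \<in> I"
        using E unfolding is_tree_def simple_graph_def by (metis card_2_iff insert_subset)
      have "(a, b) \<in> (adj (edges K'))\<^sup>*" using conn ab by (auto simp: graph_connected_def)
      moreover have "{a, b} \<notin> edges K'" using e ab by (auto simp: edges_def)
      ultimately obtain vs where "graph_cycle (insert {a, b} (edges K')) vs"
        using graph_cycle_insert ab(2) by metis
      moreover have "insert {a, b} (edges K') \<subseteq> E" using sub e ab by blast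
      ultimately have "graph_cycle E vs" by (auto simp: graph_cycle_def)
      thus False using E by (auto simp: is_tree_def)
    qed
    thus ?min using tree[OF E] K by blast
  }
qed

section \<open>Vertices of odd degree\<close>

text \<open>For a finite set of edges this is its boundary modulo 2, with symmetric difference as
  addition.\<close>

definition odd_vertices :: "'i set set \<Rightarrow> 'i set" where
  "odd_vertices F = {i. odd (card {e \<in> F. i \<in> e})}"

lemma odd_vertices_empty [simp]: "odd_vertices {} = {}"
  by (simp add: odd_vertices_def)

lemma odd_vertices_subset: "odd_vertices F \<subseteq> \<Union>F"
proof
  fix i assume "i \<in> odd_vertices F"
  hence "{e \<in> F. i \<in> e} \<noteq> {}"
    unfolding odd_vertices_def by (metis (no_types) card.empty even_zero mem_Collect_eq)
  thus "i \<in> \<Union>F" by blast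
qed

text \<open>The count of members containing \<open>i\<close> grows by one exactly when
  \<open>i\<close> is in \<open>e\<close>, so precisely the elements of \<open>e\<close> change
  parity.\<close>

lemma odd_vertices_insert:
  assumes "finite F" "e \<notin> F"
  shows "odd_vertices (insert e F) = sym_diff (odd_vertices F) e"
proof -
  have "{d \<in> insert e F. i \<in> d} =
      (if i \<in> e then insert e {d \<in> F. i \<in> d} else {d \<in> F. i \<in> d})" for i
    by auto
  thus ?thesis using assms by (auto simp: odd_vertices_def)
qed

text \<open>Additivity modulo 2: adding \<open>e\<close> and removing \<open>e\<close> toggle the
  same vertices. This lets a walk use an edge repeatedly without a case distinction.\<close>

lemma odd_vertices_sym_diff:
  assumes "finite F"
  shows "odd_vertices (sym_diff F {e}) = sym_diff (odd_vertices F) e"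
proof (cases "e \<in> F")
  case True
  hence "odd_vertices F = sym_diff (odd_vertices (F - {e})) e"
    using odd_vertices_insert[of "F - {e}" e] assms by (simp add: insert_absorb)
  moreover have "sym_diff F {e} = F - {e}" using True by blast
  ultimately show ?thesis by auto
next
  case False
  hence "sym_diff F {e} = insert e F" by blast
  thus ?thesis using odd_vertices_insert[OF assms False] by simp
qed

lemma even_card_sym_diff:
  assumes "finite A" "finite B"
  shows "even (card (sym_diff A B)) \<longleftrightarrow> even (card A + card B)"
proof -
  have "card (sym_diff A B) = card (A - B) + card (B - A)"
    using assms by (intro card_Un_disjoint) auto
  moreover have "card A = card (A - B) + card (A \<inter> B)"
    using card_Int_Diff[OF assms(1), of B] by simp
  moreover have "card B = card (B - A) + card (A \<inter> B)"
    using card_Int_Diff[OF assms(2), of A] by (simp add: Int_commute)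
  ultimately show ?thesis by auto
qed

text \<open>The handshake lemma. Each new edge toggles two vertices, which preserves the parity of
  the number of odd vertices.\<close>

lemma even_card_odd_vertices:
  assumes "finite F" "\<And>e. e \<in> F \<Longrightarrow> card e = 2"
  shows "even (card (odd_vertices F))"
  using assms
proof (induction rule: finite_induct)
  case empty
  show ?case by simp
next
  case (insert e F)
  have fin: "finite d" if "d \<in> insert e F" for d
    using insert.prems[OF that] by (auto intro: card_ge_0_finite)
  have "finite (odd_vertices F)"
    using fin insert.hyps(1) by (intro finite_subset[OF odd_vertices_subset]) auto
  moreover have "finite e" "card e = 2" using fin insert.prems by auto
  moreover have "even (card (odd_vertices F))" using insert by auto
  ultimately show ?case
    using insert.hyps by (simp add: odd_vertices_insert even_card_sym_diff)
qed

text \<open>Elements of \<open>X\<close> are removed in pairs. Once the remaining set is realized as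
  a boundary, adding a path between the two removed vertices modulo 2 restores exactly that
  pair.\<close>

lemma odd_vertices_surj:
  assumes "finite E" and conn: "graph_connected V E"
    and "finite X" "X \<subseteq> V" "even (card X)"
  shows "\<exists>F\<subseteq>E. odd_vertices F = X"
proof -
  \<comment> \<open>The path is added onto an existing \<open>F\<close>, edge by edge, so that
    toggling a single edge is the only operation required.\<close>
  have path: "\<exists>G\<subseteq>E. odd_vertices G = sym_diff (odd_vertices F) (sym_diff {u} {v})"
    if F: "F \<subseteq> E" and uv: "(u, v) \<in> (adj E)\<^sup>*" for F u v
    using uv
  proof (induction rule: rtrancl_induct)
    case base
    show ?case using F by (intro exI[of _ F]) auto
  next
    case (step y z)
    then obtain G where G: "G \<subseteq> E" "odd_vertices G = sym_diff (odd_vertices F) (sym_diff {u} {y})"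
      by blast
    \<comment> \<open>A singleton in \<open>E\<close> yields a step from \<open>y\<close> to itself.
      Toggling it would flip \<open>y\<close>, so in that case \<open>G\<close> is kept unchanged; a
      genuine edge moves the toggled endpoint from \<open>y\<close> to \<open>z\<close>.\<close>
    show ?case
    proof (cases "y = z")
      case True
      thus ?thesis using G by blast
    next
      case False
      have "finite G" using G(1) assms(1) by (rule finite_subset)
      hence "odd_vertices (sym_diff G {{y, z}}) =
          sym_diff (sym_diff (odd_vertices F) (sym_diff {u} {y})) {y, z}"
        by (simp only: odd_vertices_sym_diff G(2))
      also have "\<dots> = sym_diff (odd_vertices F) (sym_diff {u} {z})"
        using False by blast
      finally show ?thesis using G(1) step.hyps(2) by (intro exI[of _ "sym_diff G {{y, z}}"]) auto
    qed
  qed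
  show ?thesis using assms(3-5)
  proof (induction "card X" arbitrary: X rule: less_induct)
    case less
    show ?case
    proof (cases "X = {}")
      case True
      thus ?thesis by (intro exI[of _ "{}"]) auto
    next
      case False
      then obtain u where u: "u \<in> X" by blast
      have "X \<noteq> {u}" using less.prems by auto
      then obtain v where v: "v \<in> X" "v \<noteq> u" using u by blast
      let ?Y = "X - {u, v}"
      have "card {u, v} \<le> card X" using u v less.prems by (intro card_mono) auto
      hence cX: "card X = card ?Y + 2" using u v less.prems by (subst card_Diff_subset) auto
      have "even (card ?Y)" using cX less.prems(3) by simp
      then obtain F where F: "F \<subseteq> E" "odd_vertices F = ?Y"
        using less.hyps[of ?Y] cX less.prems by auto
      have "(u, v) \<in> (adj E)\<^sup>*"
        using conn u v less.prems unfolding graph_connected_def by blast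
      from path[OF F(1) this] obtain G where
        "G \<subseteq> E" "odd_vertices G = sym_diff ?Y (sym_diff {u} {v})"
        using F(2) by metis
      moreover have "sym_diff ?Y (sym_diff {u} {v}) = X" using u v by blast
      ultimately show ?thesis by auto
    qed
  qed
qed

section \<open>Generating the even strings\<close>

lemma indicator_in_Ev:
  assumes "X \<subseteq> I"
  shows "restrict (\<lambda>i. if i \<in> X then 1 else 0) I \<in> Ev I \<longleftrightarrow> even (card X)"
proof -
  have "{i \<in> I. restrict (\<lambda>i. if i \<in> X then 1 else 0 :: nat) I i = 1} = X"
    using assms by auto
  thus ?thesis unfolding Ev_def by (auto simp del: restrict_apply)
qed

text \<open>Across a partition respected by \<open>K\<close>, inputs for the two blocks can be
  chosen independently, whereas the parity constraint ties the blocks together.\<close>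

lemma generates_Ev_imp_connected:
  assumes gen: "generates I {0, 1} K (Ev I)"
  shows "complex_connected I K"
  unfolding complex_connected_def complex_disconnected_def
proof (intro notI, elim exE conjE)
  fix P Q assume PQ: "I = P \<union> Q" "P \<inter> Q = {}" "P \<noteq> {}" "Q \<noteq> {}"
    and K: "\<forall>S\<in>K. S \<subseteq> P \<or> S \<subseteq> Q"
  then obtain p q where p: "p \<in> P" and q: "q \<in> Q" by blast
  obtain B J :: "nat set" and f where fin: "finite B" "finite J"
    and im: "f ` (J \<rightarrow>\<^sub>E B) = Ev I" and KK: "communication_complex I J B f \<subseteq> K"
    using gen unfolding generates_def by blast
  have win: "determines J B f i (input_window J B f i)" for i
    by (rule input_window(1)[OF fin(2)])
  \<comment> \<open>An input read from both blocks would make \<open>{a, b}\<close> a simplex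
    crossing the partition.\<close>
  have disj: "j \<notin> input_window J B f b" if "a \<in> P" "b \<in> Q" "j \<in> input_window J B f a" for a b j
  proof
    assume "j \<in> input_window J B f b"
    moreover have "j \<in> J" using that win[of a] by (auto simp: determines_def)
    ultimately have "{a, b} \<in> communication_complex I J B f"
      using that PQ(1) by (auto simp: communication_complex_def)
    hence "{a, b} \<subseteq> P \<or> {a, b} \<subseteq> Q" using K KK by blast
    thus False using that PQ(2) by blast
  qed
  \<comment> \<open>Two even strings are spliced: the zero string, and the string with ones exactly
    at \<open>p\<close> and \<open>q\<close>. The splice keeps only the one at
    \<open>q\<close>.\<close>
  let ?char = "\<lambda>X. restrict (\<lambda>i. if i \<in> X then 1 else 0 :: nat) I"
  have "?char {} \<in> Ev I" by (subst indicator_in_Ev) auto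
  then obtain x where x: "x \<in> J \<rightarrow>\<^sub>E B" "f x = ?char {}" unfolding im[symmetric] by force
  have "p \<noteq> q" using p q PQ by blast
  hence "?char {p, q} \<in> Ev I" using p q PQ(1) by (subst indicator_in_Ev) auto
  then obtain y where y: "y \<in> J \<rightarrow>\<^sub>E B" "f y = ?char {p, q}" unfolding im[symmetric] by force
  \<comment> \<open>Inputs read by \<open>P\<close> come from \<open>x\<close>, all others from
    \<open>y\<close>. By \<open>disj\<close> the outputs on \<open>Q\<close> see only
    \<open>y\<close>.\<close>
  define w where "w j = (if \<exists>a\<in>P. j \<in> input_window J B f a then x j else y j)" for j
  have w: "w \<in> J \<rightarrow>\<^sub>E B" using x(1) y(1) by (auto simp: w_def PiE_iff extensional_def)
  have fP: "f w i = f x i" if "i \<in> P" for i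
  proof -
    have "restrict w (input_window J B f i) = restrict x (input_window J B f i)"
      using that by (intro restrict_ext) (auto simp: w_def)
    thus ?thesis using win[of i] w x(1) unfolding determines_def by blast
  qed
  have fQ: "f w i = f y i" if "i \<in> Q" for i
  proof -
    have "restrict w (input_window J B f i) = restrict y (input_window J B f i)"
      using that disj by (intro restrict_ext) (auto simp: w_def)
    thus ?thesis using win[of i] w y(1) unfolding determines_def by blast
  qed
  have "f w i = 1 \<longleftrightarrow> i = q" if "i \<in> I" for i
  proof (cases "i \<in> P")
    case True
    thus ?thesis using fP[OF True] x(2) that q PQ(2) by auto
  next
    case False
    hence "i \<in> Q" using that PQ(1) by blast
    thus ?thesis using fQ y(2) that p False by auto
  qed
  hence "{i \<in> I. f w i = 1} = {q}" using q PQ(1) by auto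
  moreover have "f w \<in> Ev I" using im w by blast
  ultimately show False by (simp add: Ev_def)
qed

text \<open>The output is the boundary modulo 2 of the set of edges carrying a one:
  \<open>even_card_odd_vertices\<close> keeps the image inside \<open>Ev I\<close>, and
  \<open>odd_vertices_surj\<close> makes it all of \<open>Ev I\<close>.\<close>

lemma connected_imp_generates_Ev:
  assumes "finite I" and K: "complex_over I K" and conn: "complex_connected I K"
  shows "generates I {0, 1} K (Ev I)"
proof -
  define E where "E = edges K"
  define char where "char X = restrict (\<lambda>i. if i \<in> X then 1 else 0 :: nat) I" for X
  define F where "F x = {e \<in> E. x e = 1}" for x :: "'a set \<Rightarrow> nat"
  define f where "f x = char (odd_vertices (F x))" for x
  have EI: "E \<subseteq> Pow I" and card2: "\<And>e. e \<in> E \<Longrightarrow> card e = 2"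
    using simple_graph_edges[OF K] by (auto simp: simple_graph_def E_def)
  have finE: "finite E" using EI assms(1) by (meson finite_Pow_iff finite_subset)
  have sub: "odd_vertices (F x) \<subseteq> I" for x
    using odd_vertices_subset[of "F x"] EI by (auto simp: F_def)
  have "f x \<in> Ev I" for x
    unfolding f_def char_def indicator_in_Ev[OF sub]
    using finE card2 by (intro even_card_odd_vertices) (auto simp: F_def)
  moreover have "g \<in> f ` (E \<rightarrow>\<^sub>E {0, 1})" if g: "g \<in> Ev I" for g
  proof -
    define X where "X = {i \<in> I. g i = 1}"
    have "finite X" "X \<subseteq> I" "even (card X)" using assms(1) g by (auto simp: X_def Ev_def)
    then obtain G where G: "G \<subseteq> E" "odd_vertices G = X"
      using odd_vertices_surj[OF finE] graph_connected_edges[OF K conn] unfolding E_def by metis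
    define x where "x = restrict (\<lambda>e. if e \<in> G then 1 else 0 :: nat) E"
    have "F x = G" using G(1) by (auto simp: F_def x_def)
    moreover have "char X = g"
    proof
      fix i show "char X i = g i"
        using g by (cases "i \<in> I") (auto simp: Ev_def char_def X_def PiE_iff extensional_def)
    qed
    ultimately have "f x = g" using G(2) by (simp add: f_def)
    moreover have "x \<in> E \<rightarrow>\<^sub>E {0, 1}" by (auto simp: x_def)
    ultimately show ?thesis by blast
  qed
  ultimately have im: "f ` (E \<rightarrow>\<^sub>E {0, 1}) = Ev I" by blast
  \<comment> \<open>An upper bound on the windows suffices, because smaller windows can only remove
    simplices from the communication complex.\<close>
  have win: "input_window E {0, 1} f i \<subseteq> {e \<in> E. i \<in> e}" for i
  proof (rule input_window(2)[OF finE])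
    have "f x i = f y i" if eq: "restrict x {e \<in> E. i \<in> e} = restrict y {e \<in> E. i \<in> e}" for x y
    proof -
      have "x e = y e" if "e \<in> E" "i \<in> e" for e
        using fun_cong[OF eq, of e] that by simp
      hence "{e \<in> F x. i \<in> e} = {e \<in> F y. i \<in> e}" by (auto simp: F_def)
      thus ?thesis by (simp add: f_def char_def odd_vertices_def restrict_def)
    qed
    thus "determines E {0, 1} f i {e \<in> E. i \<in> e}" unfolding determines_def by blast
  qed
  show ?thesis
  proof (rule generatesI[OF _ finE _ im])
    show "f \<in> (E \<rightarrow>\<^sub>E {0, 1}) \<rightarrow> (I \<rightarrow>\<^sub>E {0, 1})"
      by (auto simp: f_def char_def)
    show "communication_complex I E {0, 1} f \<subseteq> K"
    proof
      fix S assume "S \<in> communication_complex I E {0, 1} f"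
      then obtain e where e: "e \<in> E" "\<And>i. i \<in> S \<Longrightarrow> e \<in> input_window E {0, 1} f i"
        by (auto simp: communication_complex_def)
      \<comment> \<open>The common input \<open>e\<close> is itself a simplex of \<open>K\<close>
        and contains every vertex that reads it.\<close>
      hence "S \<subseteq> e" using win by blast
      moreover have "e \<in> K" using e(1) by (simp add: E_def edges_def)
      ultimately show "S \<in> K" using K by (auto simp: complex_over_def)
    qed
  qed simp
qed

text \<open>The second part starts at two elements because of
  \<open>minimal_generating_Ev_degenerate\<close>: below that, the empty complex is the only minimal
  one and is not a spanning tree.\<close>

theorem proposition3p1:
  fixes I :: "'i set"
  assumes "finite I"
  shows "(\<forall>K. complex_over I K \<longrightarrow>
            (generates I {0, 1} K (Ev I) \<longleftrightarrow> complex_connected I K)) \<and>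
         (2 \<le> card I \<longrightarrow>
            (\<forall>K. minimal_generating I {0, 1} K (Ev I) \<longleftrightarrow> tree_spanning I K))"
proof (intro conjI allI impI)
  have iff: "generates I {0, 1} K (Ev I) \<longleftrightarrow> complex_connected I K" if "complex_over I K" for K
    using generates_Ev_imp_connected connected_imp_generates_Ev assms that by blast
  fix K
  show "generates I {0, 1} K (Ev I) \<longleftrightarrow> complex_connected I K" if "complex_over I K"
    using iff that .
  show "minimal_generating I {0, 1} K (Ev I) \<longleftrightarrow> tree_spanning I K" if "2 \<le> card I"
    \<comment> \<open>Applied to \<open>K\<close> and to all complexes below it, \<open>iff\<close>
      turns minimality among generating complexes into minimality among connected ones.\<close>
    using minimal_connected_iff_tree[OF assms that, of K] iff
    unfolding minimal_generating_def by blast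
qed

end
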